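(* Let $N=\{1,\dots,n\}$, $X=[0,1]^n$, and let $\succcurlyeq$ be a binary relation on $X$ for which no $i\in N$ is null. Assume that $\succcurlyeq$ satisfies axioms (A1), (A2) and (A3): (A1) $\succcurlyeq$ is complete and transitive. (A2) For every non-empty $I\subseteq N$ and all $x,y,z,x',y'\in X$: if $x'_i\sim x_i I z_i$ and $y'_i\sim y_i I z_i$ for all $i\in N$, then $x\succ y$ if and only if $x'\succ y'$. (A3) For all $x,y\in\Delta$, $x>y$ implies $x\succ y$. Furthermore, there exists $I^*\subseteq N$ such that $xI^*y\sim yI^*x$ for all $x,y\in\Delta$. If $\succcurlyeq$ is mixture-continuous, then it is strongly monotone, i.e. for all $x,y\in X$, $x>y$ implies $x\succ y$.
   Context: $\succ$ and $\sim$ are the asymmetric and symmetric parts of $\succcurlyeq$: $x\succ y$ iff $x\succcurlyeq y$ and not $y\succcurlyeq x$; $x\sim y$ iff $x\succcurlyeq y$ and $y\succcurlyeq x$. For vectors, $x>y$ means $x_i\ge y_i$ for every $i$ and $x\neq y$. Complete: $x\succcurlyeq y$ or $y\succcurlyeq x$ for all $x,y\in X$. $\Delta=\{x\in X: x_i=x_j \text{ for all } i,j\in N\}$. A number $t\in[0,1]$ is identified with the constant vector $(t,\dots,t)\in\Delta$ (so, e.g., in (A2) $x_i,z_i,x_i'$ are read as constant vectors). For $I\subseteq N$ and $x,y\in\Delta$, $xIy$ denotes the vector $z\in X$ with $z_i=x_i$ for $i\in I$ and $z_i=y_i$ for $i\notin I$. A non-empty set $I\subseteq N$ is null if for all $x,y\in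 X$, $x_i=y_i$ for all $i\in N\setminus I$ implies $x\sim y$; $i\in N$ is null if $\{i\}$ is null. Mixture-continuous: for all $x,y,z\in X$, the sets $\{\lambda\in[0,1]: \lambda x+(1-\lambda)y\succcurlyeq z\}$ and $\{\lambda\in[0,1]: z\succcurlyeq\lambda x+(1-\lambda)y\}$ are closed. *)

theory Defs
  imports "HOL-Analysis.Analysis"
begin

text \<open>
  The index set \<open>N\<close> is the finite type \<open>'n\<close> and \<open>n = CARD('n)\<close>. A binary relation on \<open>X\<close> is
  rendered as a predicate on the whole of \<open>real ^ 'n\<close>; its values outside \<open>X\<close> are unconstrained
  and never used. Recall that the library order on \<open>real ^ 'n\<close> is the
  componentwise one, so that \<open>x > y\<close> means \<open>x $ i \<ge> y $ i\<close> for all \<open>i\<close> and \<open>x \<noteq> y\<close>.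
\<close>

type_synonym 'n pref = "real ^ 'n \<Rightarrow> real ^ 'n \<Rightarrow> bool"

definition X :: "(real ^ 'n) set" where
  "X = {x. \<forall>i. 0 \<le> x $ i \<and> x $ i \<le> 1}"

definition Diag :: "(real ^ 'n) set" where
  "Diag = {x \<in> X. \<forall>i j. x $ i = x $ j}"

definition strict_pref :: "('n::finite) pref \<Rightarrow> 'n pref" where
  "strict_pref R x y \<longleftrightarrow> R x y \<and> \<not> R y x"

definition indiff :: "('n::finite) pref \<Rightarrow> 'n pref" where
  "indiff R x y \<longleftrightarrow> R x y \<and> R y x"

text \<open>The vector \<open>xIy\<close>.\<close>

definition splice_vec :: "'n set \<Rightarrow> real ^ 'n \<Rightarrow> real ^ 'n \<Rightarrow> real ^ 'n" where
  "splice_vec I x y = (\<chi> i. if i \<in> I then x $ i else y $ i)"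

definition null_set :: "('n::finite) pref \<Rightarrow> 'n set \<Rightarrow> bool" where
  "null_set R I \<longleftrightarrow> I \<noteq> {} \<and>
     (\<forall>x\<in>X. \<forall>y\<in>X. (\<forall>i. i \<notin> I \<longrightarrow> x $ i = y $ i) \<longrightarrow> indiff R x y)"

definition null_index :: "('n::finite) pref \<Rightarrow> 'n \<Rightarrow> bool" where
  "null_index R i \<longleftrightarrow> null_set R {i}"

definition A1 :: "('n::finite) pref \<Rightarrow> bool" where
  "A1 R \<longleftrightarrow> (\<forall>x\<in>X. \<forall>y\<in>X. R x y \<or> R y x) \<and>
     (\<forall>x\<in>X. \<forall>y\<in>X. \<forall>z\<in>X. R x y \<longrightarrow> R y z \<longrightarrow> R x z)"

text \<open>A number \<open>t\<close> is identified with the constant vector \<open>vec t\<close>.\<close>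

definition A2 :: "('n::finite) pref \<Rightarrow> bool" where
  "A2 R \<longleftrightarrow> (\<forall>I. I \<noteq> {} \<longrightarrow>
     (\<forall>x\<in>X. \<forall>y\<in>X. \<forall>z\<in>X. \<forall>x'\<in>X. \<forall>y'\<in>X.
        (\<forall>i. indiff R (vec (x' $ i)) (splice_vec I (vec (x $ i)) (vec (z $ i))) \<and>
             indiff R (vec (y' $ i)) (splice_vec I (vec (y $ i)) (vec (z $ i)))) \<longrightarrow>
        (strict_pref R x y \<longleftrightarrow> strict_pref R x' y')))"

definition A3 :: "('n::finite) pref \<Rightarrow> bool" where
  "A3 R \<longleftrightarrow> (\<forall>x\<in>Diag. \<forall>y\<in>Diag. x > y \<longrightarrow> strict_pref R x y) \<and>
     (\<exists>I. \<forall>x\<in>Diag. \<forall>y\<in>Diag. indiff R (splice_vec I x y) (splice_vec I y x))"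

definition mixture_continuous :: "('n::finite) pref \<Rightarrow> bool" where
  "mixture_continuous R \<longleftrightarrow> (\<forall>x\<in>X. \<forall>y\<in>X. \<forall>z\<in>X.
     closed {l \<in> {0..1::real}. R (l *\<^sub>R x + (1 - l) *\<^sub>R y) z} \<and>
     closed {l \<in> {0..1::real}. R z (l *\<^sub>R x + (1 - l) *\<^sub>R y)})"

definition strongly_monotone :: "('n::finite) pref \<Rightarrow> bool" where
  "strongly_monotone R \<longleftrightarrow> (\<forall>x\<in>X. \<forall>y\<in>X. x > y \<longrightarrow> strict_pref R x y)"

end

theory Submission
  imports Defs
begin

text \<open>
  By (A2) with constant vectors, \<open>aIc \<sim> c\<close> forces \<open>a = c\<close>. Together with continuity along segments
  this shows that \<open>aIc\<close> lies strictly between \<open>a\<close> and \<open>c\<close>; so it has a certainty equivalent, and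
  (A2) makes that equivalent strictly increasing in \<open>a\<close>.

  Now let \<open>x\<close> and \<open>y\<close> differ only in coordinate \<open>i\<close>, with \<open>x\<^sub>i > y\<^sub>i\<close>, and let \<open>e \<sim> 1I\<^sup>*0 \<sim> 0I\<^sup>*1\<close>.
  Every \<open>x\<^sub>j\<close> admits some \<open>z\<^sub>j\<close> with \<open>x\<^sub>jI\<^sup>*z\<^sub>j \<sim> e\<close>. Mixing with this \<open>z\<close> as in (A2) turns \<open>x\<close> into
  the constant \<open>e\<close>, and \<open>y\<close> into \<open>t{i}e\<close> for some \<open>t < e\<close>. Hence \<open>x \<succ> y\<close>.
\<close>

text \<open>Keeps \<open>vec 0\<close> and \<open>vec 1\<close> in the form \<open>vec t\<close>, so
  that rules about constant vectors also match the two extremes.\<close>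

declare vec_0 [simp del] vec_1 [simp del]

section \<open>Two-valued vectors \<open>aIc\<close>\<close>

definition binary :: "'n set \<Rightarrow> real \<Rightarrow> real \<Rightarrow> real ^ 'n" where
  "binary I a c = splice_vec I (vec a) (vec c)"

lemma binary_nth [simp]: "binary I a c $ i = (if i \<in> I then a else c)"
  by (simp add: binary_def splice_vec_def)

lemma binary_same [simp]: "binary I a a = vec a"
  by (simp add: vec_eq_iff)

lemma binary_Compl: "binary (- I) a c = binary I c a"
  by (simp add: vec_eq_iff)

text \<open>For fixed \<open>I\<close> the two-valued vectors are closed under mixing, so a crossing
  point on a segment between two of them is again two-valued.\<close>

lemma binary_mix:
  "l *\<^sub>R binary I a c + (1 - l) *\<^sub>R binary I a' c'
     = binary I (l * a + (1 - l) * a') (l * c + (1 - l) * c')"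
  by (simp add: vec_eq_iff)

lemma binary_mem_X [simp]:
  assumes "a \<in> {0..1}" and "c \<in> {0..1}"
  shows "binary I a c \<in> X"
  using assms by (simp add: X_def)

lemma vec_mem_X [simp]: "a \<in> {0..1} \<Longrightarrow> vec a \<in> X"
  by (simp add: X_def)

lemma vec_mem_Diag: "a \<in> {0..1} \<Longrightarrow> vec a \<in> Diag"
  by (simp add: Diag_def)

lemma nth_mem_unit: "x \<in> X \<Longrightarrow> x $ i \<in> {0..1}"
  by (simp add: X_def)

lemma mix_mem_unit:
  fixes a b l :: real
  assumes "a \<in> {0..1}" and "b \<in> {0..1}" and "l \<in> {0..1}"
  shows "l * a + (1 - l) * b \<in> {0..1}"
  using convexD_alt [OF convex_real_interval(5), of b 0 1 a l] assms
  by (simp add: add.commute)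

lemma vec_less_vec: "(vec a :: real ^ 'n) < vec b \<longleftrightarrow> a < b"
  by (auto simp: less_vec_def less_eq_vec_def)

section \<open>The weak order and its restriction to constant vectors\<close>

locale continuous_A123 =
  fixes R :: "'n::finite pref"
  assumes A1: "A1 R" and A2: "A2 R" and A3: "A3 R"
    and continuity: "mixture_continuous R"
begin

lemma complete: "x \<in> X \<Longrightarrow> y \<in> X \<Longrightarrow> R x y \<or> R y x"
  using A1 unfolding A1_def by blast

lemma refl: "x \<in> X \<Longrightarrow> R x x"
  using complete by blast

lemma trans: "R x y \<Longrightarrow> R y z \<Longrightarrow> x \<in> X \<Longrightarrow> y \<in> X \<Longrightarrow> z \<in> X \<Longrightarrow> R x z"
  using A1 unfolding A1_def by blast

lemma strict_pref_trans:
  assumes "strict_pref R x y" and "strict_pref R y z" and "x \<in> X" and "y \<in> X" and "z \<in> X"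
  shows "strict_pref R x z"
  using assms trans unfolding strict_pref_def by blast

lemma indiff_sym: "indiff R x y \<Longrightarrow> indiff R y x"
  by (simp add: indiff_def)

lemma R_cong:
  assumes "indiff R x x'" and "indiff R y y'" and "x \<in> X" and "x' \<in> X" and "y \<in> X" and "y' \<in> X"
  shows "R x y \<longleftrightarrow> R x' y'"
proof -
  have "R u' v'"
    if "R u v" "indiff R u u'" "indiff R v v'" "u \<in> X" "u' \<in> X" "v \<in> X" "v' \<in> X"
    for u u' v v'
    using trans [of u' u v] trans [of u' v v'] that by (simp add: indiff_def)
  then show ?thesis
    using assms indiff_sym by blast
qed

lemma strict_pref_cong:
  assumes "indiff R x x'" and "indiff R y y'" and "x \<in> X" and "x' \<in> X" and "y \<in> X" and "y' \<in> X"
  shows "strict_pref R x y \<longleftrightarrow> strict_pref R x' y'"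
  using R_cong [OF assms] R_cong [OF assms(2,1,5,6,3,4)] by (simp add: strict_pref_def)

lemma strict_pref_vec:
  assumes "a \<in> {0..1}" and "b \<in> {0..1}"
  shows "strict_pref R (vec a) (vec b) \<longleftrightarrow> b < a"
proof -
  have *: "strict_pref R (vec a) (vec b)" if "b < a" "a \<in> {0..1}" "b \<in> {0..1}" for a b
    using A3 that vec_less_vec vec_mem_Diag unfolding A3_def by blast
  show ?thesis
    using * [of a b] * [of b a] assms unfolding strict_pref_def
    by (cases a b rule: linorder_cases) auto
qed

lemma R_vec:
  assumes "a \<in> {0..1}" and "b \<in> {0..1}"
  shows "R (vec a) (vec b) \<longleftrightarrow> b \<le> a"
  using strict_pref_vec [of b a] complete [of "vec a" "vec b"] assms
  unfolding strict_pref_def by force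

lemma binary_A2:
  assumes "I \<noteq> {}" and "x \<in> X" and "y \<in> X" and "z \<in> X" and "x' \<in> X" and "y' \<in> X"
    and "\<And>i. indiff R (vec (x' $ i)) (binary I (x $ i) (z $ i))"
    and "\<And>i. indiff R (vec (y' $ i)) (binary I (y $ i) (z $ i))"
  shows "strict_pref R x y \<longleftrightarrow> strict_pref R x' y'"
  using A2 [unfolded A2_def, rule_format, OF assms(1-6)] assms(7,8) by (simp add: binary_def)

section \<open>Crossings along segments and certainty equivalents\<close>

lemma segment_crossing:
  assumes p: "p \<in> X" and q: "q \<in> X" and z: "z \<in> X" and pz: "R p z" and zq: "R z q"
  obtains l where "l \<in> {0..1}" and "indiff R (l *\<^sub>R p + (1 - l) *\<^sub>R q) z"
proof -
  let ?m = "\<lambda>l. l *\<^sub>R p + (1 - l) *\<^sub>R q"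
  let ?U = "{l \<in> {0..1::real}. R (?m l) z}" and ?L = "{l \<in> {0..1::real}. R z (?m l)}"
  have m: "?m l \<in> X" if "l \<in> {0..1}" for l
    using mix_mem_unit [OF nth_mem_unit [OF p] nth_mem_unit [OF q] that] by (simp add: X_def)
  have "closed ?U" "closed ?L"
    using continuity p q z unfolding mixture_continuous_def by blast+
  moreover have "{0..1} \<subseteq> ?U \<union> ?L"
    using complete m z by blast
  moreover have "1 \<in> ?U \<inter> {0..1}" "0 \<in> ?L \<inter> {0..1}"
    using pz zq by auto
  then have "?U \<inter> {0..1} \<noteq> {}" "?L \<inter> {0..1} \<noteq> {}"
    by blast+
  \<comment> \<open>The unit interval is connected and is covered by two closed sets that both meet
    it, so these share a point.\<close>
  ultimately have "?U \<inter> ?L \<inter> {0..1} \<noteq> {}"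
    using connected_closedD [OF connected_Icc, of ?U ?L 0 1] by metis
  then show ?thesis
    using that unfolding indiff_def by blast
qed

lemma binary_crossing:
  assumes "a \<in> {0..1}" and "c \<in> {0..1}" and "a' \<in> {0..1}" and "c' \<in> {0..1}" and "z \<in> X"
    and "R (binary I a c) z" and "R z (binary I a' c')"
  obtains l where "l \<in> {0..1}"
    and "indiff R (binary I (l * a + (1 - l) * a') (l * c + (1 - l) * c')) z"
  using segment_crossing [OF binary_mem_X [OF assms(1,2)] binary_mem_X [OF assms(3,4)] assms(5-7)]
  unfolding binary_mix by blast

text \<open>The segment from \<open>vec 0\<close> to \<open>vec 1\<close> is the diagonal, so the
  crossing point is a constant.\<close>

lemma certainty_equivalent:
  assumes "p \<in> X" and "R (vec 1) p" and "R p (vec 0)"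
  obtains t where "t \<in> {0..1}" and "indiff R (vec t) p"
  using binary_crossing [of 1 1 0 0 p UNIV] assms by auto

section \<open>Comparison of \<open>aIc\<close> with \<open>c\<close>\<close>

lemma binary_mono_equivalents:
  assumes "I \<noteq> {}" and "a \<in> {0..1}" and "b \<in> {0..1}" and "c \<in> {0..1}"
    and "s \<in> {0..1}" and "t \<in> {0..1}"
    and "indiff R (vec s) (binary I a c)" and "indiff R (vec t) (binary I b c)"
  shows "a < b \<longleftrightarrow> s < t"
  \<comment> \<open>For constant vectors the coordinatewise premises of (A2) all say the same, and
    strict preference is the order of numbers.\<close>
  using binary_A2 [of I "vec b" "vec a" "vec c" "vec t" "vec s"] assms
  by (simp add: strict_pref_vec)

text \<open>Otherwise \<open>c\<close> would be a certainty equivalent of both \<open>aIc\<close>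
  and \<open>cIc\<close>, and (A2) would order \<open>a\<close> and \<open>c\<close> as it orders
  \<open>c\<close> and itself.\<close>

lemma binary_not_indiff:
  assumes "I \<noteq> {}" and "a \<in> {0..1}" and "c \<in> {0..1}" and "a \<noteq> c"
  shows "\<not> indiff R (binary I a c) (vec c)"
proof
  assume "indiff R (binary I a c) (vec c)"
  then have "indiff R (vec c) (binary I a c)" "indiff R (vec c) (binary I c c)"
    using assms refl by (auto simp: indiff_def)
  then show False
    using assms binary_mono_equivalents [of I a c c c c] binary_mono_equivalents [of I c a c c c]
    by (auto simp: linorder_neq_iff)
qed

text \<open>Nothing yet places \<open>aIc\<close> between \<open>vec 0\<close> and
  \<open>vec 1\<close>, so it may lack a certainty equivalent. An interior \<open>c\<close> is
  strictly between them, and by continuity this persists when \<open>a\<close> is pulled close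
  enough to \<open>c\<close>.\<close>

lemma near_constant_bounded:
  assumes c: "0 < c" "c < 1" and a: "a \<in> {0..1}"
  obtains l where "0 < l" and "l \<le> 1"
    and "R (vec 1) (binary I (l * a + (1 - l) * c) c)"
    and "R (binary I (l * a + (1 - l) * c) c) (vec 0)"
proof -
  let ?m = "\<lambda>l. binary I (l * a + (1 - l) * c) c"
  let ?U = "{l \<in> {0..1::real}. R (?m l) (vec 1)}" and ?L = "{l \<in> {0..1::real}. R (vec 0) (?m l)}"
  have m: "l *\<^sub>R binary I a c + (1 - l) *\<^sub>R binary I c c = ?m l" for l
    unfolding binary_mix by (simp add: algebra_simps)
  have "binary I a c \<in> X" "binary I c c \<in> X" "vec 0 \<in> X" "vec 1 \<in> X"
    using a c by (simp_all del: binary_same)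
  then have "closed ?U" "closed ?L"
    using continuity unfolding mixture_continuous_def m [symmetric] by blast+
  then have "open (- (?U \<union> ?L))"
    by (intro open_Compl closed_Un)
  moreover have "0 \<in> - (?U \<union> ?L)"
    using c by (simp add: R_vec)
  ultimately obtain e where e: "0 < e" "ball 0 e \<subseteq> - (?U \<union> ?L)"
    using open_contains_ball by blast
  \<comment> \<open>The ball may reach beyond 1; the minimum keeps \<open>l\<close> in the unit
    interval, where avoiding \<open>?U\<close> and \<open>?L\<close> yields both bounds by
    completeness.\<close>
  define l where "l = min 1 (e / 2)"
  have l: "0 < l" "l \<le> 1" "l < e"
    using e(1) by (auto simp: l_def)
  then have "l \<in> ball 0 e"
    by (simp add: dist_real_def)
  then have "l \<notin> ?U" "l \<notin> ?L"
    using e(2) by blast+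
  moreover have "?m l \<in> X"
    using a c l by (intro binary_mem_X mix_mem_unit) auto
  ultimately show ?thesis
    using that [of l] l complete [of "?m l" "vec 1"] complete [of "?m l" "vec 0"] by auto
qed

text \<open>The positive product puts \<open>a\<close> and \<open>a'\<close> strictly on one side of
  \<open>c\<close>. If the verdict changed between them, a crossing would give \<open>bIc\<close>
  \<sim> \<open>c\<close> for some \<open>b\<close> on that side, hence different from
  \<open>c\<close>.\<close>

lemma binary_same_side:
  assumes I: "I \<noteq> {}" and a: "a \<in> {0..1}" and a': "a' \<in> {0..1}" and c: "c \<in> {0..1}"
    and side: "0 < (a - c) * (a' - c)"
    and pref: "R (binary I a c) (vec c)"
  shows "R (binary I a' c) (vec c)"
proof (rule ccontr)
  assume "\<not> R (binary I a' c) (vec c)"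
  then have "R (vec c) (binary I a' c)"
    using complete [of "vec c" "binary I a' c"] a' c by simp
  then obtain l where l: "l \<in> {0..1}"
    "indiff R (binary I (l * a + (1 - l) * a') (l * c + (1 - l) * c)) (vec c)"
    using binary_crossing [of a c a' c "vec c" I] a a' c pref by auto
  have "l * a + (1 - l) * a' \<noteq> c"
  proof (cases "c < a")
    case True
    then have "0 < l * (a - c) + (1 - l) * (a' - c)"
      using side l(1) by (cases "l = 0") (auto simp: zero_less_mult_iff intro!: add_pos_nonneg)
    then show ?thesis
      by (simp add: algebra_simps)
  next
    case False
    then have "0 < l * (c - a) + (1 - l) * (c - a')"
      using side l(1) by (cases "l = 0") (auto simp: zero_less_mult_iff intro!: add_pos_nonneg)
    then show ?thesis
      by (simp add: algebra_simps)
  qed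
  moreover have "l * c + (1 - l) * c = c"
    by (simp add: algebra_simps)
  ultimately show False
    using binary_not_indiff [OF I mix_mem_unit [OF a a' l(1)] c] l(2) by simp
qed

lemma R_binary_interior:
  assumes I: "I \<noteq> {}" and a: "a \<in> {0..1}" and c: "0 < c" "c < 1" and ne: "a \<noteq> c"
  shows "R (binary I a c) (vec c) \<longleftrightarrow> c < a"
proof -
  obtain l where l: "0 < l" "l \<le> 1"
    and bd: "R (vec 1) (binary I (l * a + (1 - l) * c) c)"
      "R (binary I (l * a + (1 - l) * c) c) (vec 0)"
    using near_constant_bounded [OF c a] by blast
  \<comment> \<open>\<open>a'\<close> stands in for \<open>a\<close>: it is on the same side of
    \<open>c\<close>, so the verdict is the same, but \<open>a'Ic\<close> has a certainty equivalent
    \<open>t\<close>, which (A2) orders against \<open>c\<close> as \<open>a'\<close> is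
    ordered.\<close>
  define a' where "a' = l * a + (1 - l) * c"
  have a': "a' \<in> {0..1}"
    unfolding a'_def using a c l by (intro mix_mem_unit) auto
  have diff: "a' - c = l * (a - c)"
    by (simp add: a'_def algebra_simps)
  have side: "0 < (a - c) * (a' - c)" "0 < (a' - c) * (a - c)"
    using l ne unfolding diff by (auto simp: zero_less_mult_iff mult_less_0_iff)
  have c': "c \<in> {0..1}"
    using c by simp
  obtain t where t: "t \<in> {0..1}" "indiff R (vec t) (binary I a' c)"
    using certainty_equivalent [OF binary_mem_X [OF a' c'] bd [folded a'_def]] .
  have cc: "indiff R (vec c) (binary I c c)"
    using c' refl by (simp add: indiff_def)
  have "R (binary I a c) (vec c) \<longleftrightarrow> R (binary I a' c) (vec c)"
    using binary_same_side [OF I a a' c' side(1)] binary_same_side [OF I a' a c' side(2)] by blast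
  also have "\<dots> \<longleftrightarrow> R (vec t) (vec c)"
    using R_cong [OF t(2), of "vec c" "vec c"] t(1) a' c' refl [of "vec c"]
    by (simp add: indiff_def)
  also have "\<dots> \<longleftrightarrow> c \<le> t"
    by (rule R_vec [OF t(1) c'])
  also have "\<dots> \<longleftrightarrow> c \<le> a'"
    using binary_mono_equivalents [OF I a' c' c' t(1) c' t(2) cc] by linarith
  also have "\<dots> \<longleftrightarrow> c < a"
    using diff l ne by (smt (verit) mult_less_0_iff mult_pos_pos)
  finally show ?thesis .
qed

lemma binary_pref_lower:
  assumes I: "I \<noteq> {}" and a: "a \<in> {0..1}" and c: "c \<in> {0..1}" and ca: "c < a"
  shows "strict_pref R (binary I a c) (vec c)"
proof -
  have R: "R (binary I a c) (vec c)"
  proof (cases "c = 0")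
    case False
    then show ?thesis
      using R_binary_interior [OF I a, of c] c a ca by auto
  next
    case True
    show ?thesis
    proof (rule ccontr)
      \<comment> \<open>At the endpoint 0 the value off \<open>I\<close> is raised towards
        \<open>a\<close> instead. A crossing gives \<open>aIb\<close> \<sim> 0 with
        \<open>0 < b \<le> a\<close>, whereas the interior case, or \<open>b = a\<close>, makes
        \<open>aIb\<close> at least as good as \<open>b\<close>, which is better than 0.\<close>
      assume n: "\<not> R (binary I a c) (vec c)"
      then have "R (vec 0) (binary I a 0)"
        using complete [of "vec 0" "binary I a 0"] True a by simp
      moreover have "R (binary I a a) (vec 0)"
        using a by (simp add: R_vec)
      ultimately obtain l where l: "l \<in> {0..1}"
        "indiff R (binary I (l * a + (1 - l) * a) (l * a + (1 - l) * 0)) (vec 0)"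
        using binary_crossing [of a a a 0 "vec 0" I] a by auto
      define b where "b = l * a"
      have b: "b \<in> {0..1}" "b \<le> a"
        using l(1) a mult_left_le_one_le [of a l] by (auto simp: b_def)
      have ab: "indiff R (binary I a b) (vec 0)"
        using l(2) by (simp add: b_def algebra_simps)
      then have "b \<noteq> 0"
        using n True by (auto simp: indiff_def)
      then have b0: "0 < b"
        using b by simp
      have "R (binary I a b) (vec b)"
      proof (cases "b = a")
        case True
        then show ?thesis
          using a refl by simp
      next
        case False
        then show ?thesis
          using R_binary_interior [OF I a, of b] b b0 a by auto
      qed
      then have "R (vec 0) (vec b)"
        using ab trans [of "vec 0" "binary I a b" "vec b"] a b by (simp add: indiff_def)
      then show False
        using R_vec [of 0 b] b b0 by auto
    qed
  qed
  then show ?thesis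
    using binary_not_indiff [OF I a c] ca unfolding strict_pref_def indiff_def by auto
qed

lemma binary_pref_upper:
  assumes I: "I \<noteq> {}" and a: "a \<in> {0..1}" and c: "c \<in> {0..1}" and ac: "a < c"
  shows "strict_pref R (vec c) (binary I a c)"
proof -
  have "\<not> R (binary I a c) (vec c)"
  proof (cases "c = 1")
    case False
    then show ?thesis
      using R_binary_interior [OF I a, of c] c a ac by auto
  next
    case True
    show ?thesis
    proof
      \<comment> \<open>Dually at the endpoint 1: lowering the value off \<open>I\<close> towards
        \<open>a\<close> gives \<open>aIb\<close> \<sim> 1 with \<open>a \<le> b < 1\<close>,
        although \<open>b\<close> is at least as good as \<open>aIb\<close>.\<close>
      assume r: "R (binary I a c) (vec c)"
      moreover have "R (vec 1) (binary I a a)"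
        using a by (simp add: R_vec)
      ultimately obtain l where l: "l \<in> {0..1}"
        "indiff R (binary I (l * a + (1 - l) * a) (l * 1 + (1 - l) * a)) (vec 1)"
        using binary_crossing [of a 1 a a "vec 1" I] a True by auto
      define b where "b = l * 1 + (1 - l) * a"
      have b: "b \<in> {0..1}"
        unfolding b_def using a l(1) by (intro mix_mem_unit) auto
      have "0 \<le> l * (1 - a)"
        using l(1) a by simp
      then have ab: "a \<le> b"
        by (simp add: b_def algebra_simps)
      have ind: "indiff R (binary I a b) (vec 1)"
        using l(2) by (simp add: b_def algebra_simps)
      then have "b \<noteq> 1"
        using binary_not_indiff [OF I a c] ac True by auto
      then have b1: "b < 1"
        using b by simp
      have "R (vec b) (binary I a b)"
      proof (cases "b = a")
        case True
        then show ?thesis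
          using a refl by simp
      next
        case False
        then have "\<not> R (binary I a b) (vec b)"
          using R_binary_interior [OF I a, of b] b1 ab a by auto
        then show ?thesis
          using complete [of "vec b" "binary I a b"] a b by simp
      qed
      then have "R (vec b) (vec 1)"
        using ind trans [of "vec b" "binary I a b" "vec 1"] a b by (simp add: indiff_def)
      then show False
        using R_vec [of b 1] b b1 by auto
    qed
  qed
  then show ?thesis
    using complete [of "vec c" "binary I a c"] a c unfolding strict_pref_def by simp
qed

lemma binary_pref_ge_lower:
  assumes "I \<noteq> {}" and "a \<in> {0..1}" and "c \<in> {0..1}" and "c \<le> a"
  shows "R (binary I a c) (vec c)"
  using binary_pref_lower [of I a c] refl [of "vec c"] assms
  by (cases "a = c") (auto simp: strict_pref_def)

lemma binary_pref_le_upper: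
  assumes "I \<noteq> {}" and "a \<in> {0..1}" and "c \<in> {0..1}" and "a \<le> c"
  shows "R (vec c) (binary I a c)"
  using binary_pref_upper [of I a c] refl [of "vec c"] assms
  by (cases "a = c") (auto simp: strict_pref_def)

section \<open>Certainty equivalents and monotonicity of \<open>aIc\<close>\<close>

lemma binary_certainty_equivalent:
  assumes I: "I \<noteq> {}" "- I \<noteq> {}" and a: "a \<in> {0..1}" and c: "c \<in> {0..1}"
  obtains t where "t \<in> {0..1}" and "indiff R (vec t) (binary I a c)"
proof -
  \<comment> \<open>Comparison over \<open>I\<close> bounds \<open>aIc\<close> by \<open>c\<close>
    only; reading it as \<open>c(-I)a\<close> supplies the bound by \<open>a\<close> on the other
    side.\<close>
  have bounds: "R (vec (max a c)) (binary I a c) \<and> R (binary I a c) (vec (min a c))"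
    using binary_pref_ge_lower [OF I(1) a c] binary_pref_ge_lower [OF I(2) c a]
      binary_pref_le_upper [OF I(1) a c] binary_pref_le_upper [OF I(2) c a]
    by (simp add: binary_Compl max_def min_def)
  have mem: "max a c \<in> {0..1}" "min a c \<in> {0..1}"
    using a c by auto
  have "R (vec 1) (binary I a c)"
    using bounds mem a c trans [of "vec 1" "vec (max a c)" "binary I a c"] R_vec [of 1 "max a c"]
    by auto
  moreover have "R (binary I a c) (vec 0)"
    using bounds mem a c trans [of "binary I a c" "vec (min a c)" "vec 0"] R_vec [of "min a c" 0]
    by auto
  ultimately show ?thesis
    using certainty_equivalent that a c by (metis binary_mem_X)
qed

lemma binary_strict_mono:
  assumes I: "I \<noteq> {}" "- I \<noteq> {}" and a: "a \<in> {0..1}" and b: "b \<in> {0..1}" and c: "c \<in> {0..1}"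
    and less: "a < b"
  shows "strict_pref R (binary I b c) (binary I a c)"
proof -
  obtain s where s: "s \<in> {0..1}" "indiff R (vec s) (binary I a c)"
    using binary_certainty_equivalent [OF I a c] .
  obtain t where t: "t \<in> {0..1}" "indiff R (vec t) (binary I b c)"
    using binary_certainty_equivalent [OF I b c] .
  have "s < t"
    using binary_mono_equivalents [OF I(1) a b c s(1) t(1) s(2) t(2)] less by simp
  then show ?thesis
    using strict_pref_cong [OF t(2) s(2)] s(1) t(1) a b c by (simp add: strict_pref_vec)
qed

section \<open>Strong monotonicity, one coordinate at a time\<close>

lemma strict_pref_single_coordinate:
  assumes x: "x \<in> X" and y: "y \<in> X" and less: "y $ i < x $ i"
    and eq: "\<And>j. j \<noteq> i \<Longrightarrow> x $ j = y $ j"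
  shows "strict_pref R x y"
proof -
  obtain I where "\<forall>x\<in>Diag. \<forall>y\<in>Diag. indiff R (splice_vec I x y) (splice_vec I y x)"
    using A3 unfolding A3_def by blast
  then have swap: "indiff R (binary I 1 0) (binary I 0 1)"
    by (simp add: binary_def vec_mem_Diag)
  have not_indiff: "\<not> indiff R (vec 1) (vec 0)" "\<not> indiff R (vec 0) (vec 1)"
    by (simp_all add: indiff_def R_vec)
  \<comment> \<open>For a trivial \<open>I\<close> the symmetry would read 1 \<sim> 0.\<close>
  have "I \<noteq> {}" "I \<noteq> UNIV"
  proof -
    have "binary {} a c = (vec c :: real ^ 'n)" "binary UNIV a c = (vec a :: real ^ 'n)" for a c :: real
      by (simp_all add: vec_eq_iff)
    then show "I \<noteq> {}" "I \<noteq> UNIV"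
      using swap not_indiff by auto
  qed
  then have I: "I \<noteq> {}" "- I \<noteq> {}"
    by auto
  obtain e where e: "e \<in> {0..1}" and e10: "indiff R (vec e) (binary I 1 0)"
    using binary_certainty_equivalent [OF I, of 1 0] by auto
  have e01: "indiff R (vec e) (binary I 0 1)"
    using e e10 swap trans [of "vec e" "binary I 1 0" "binary I 0 1"]
      trans [of "binary I 0 1" "binary I 1 0" "vec e"] by (simp add: indiff_def)
  \<comment> \<open>Both representations of \<open>e\<close> matter here: raising \<open>0I1\<close>
    to \<open>x $ j\<close> on \<open>I\<close> gives a vector at least as good as \<open>e\<close>,
    and lowering \<open>1I0\<close> gives one at most as good. Varying the value off
    \<open>I\<close> from 1 to 0 therefore crosses \<open>e\<close>.\<close>
  have "\<exists>c\<in>{0..1}. indiff R (vec e) (binary I (x $ j) c)" for j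
  proof -
    have xj: "x $ j \<in> {0..1}"
      by (rule nth_mem_unit [OF x])
    have "R (binary I (x $ j) 1) (binary I 0 1)"
      using binary_strict_mono [OF I, of 0 "x $ j" 1] xj refl [of "binary I 0 1"]
      by (cases "x $ j = 0") (auto simp: strict_pref_def)
    then have upper: "R (binary I (x $ j) 1) (vec e)"
      using e01 trans [of "binary I (x $ j) 1" "binary I 0 1" "vec e"] xj e
      by (simp add: indiff_def)
    have "R (binary I 1 0) (binary I (x $ j) 0)"
      using binary_strict_mono [OF I, of "x $ j" 1 0] xj refl [of "binary I 1 0"]
      by (cases "x $ j = 1") (auto simp: strict_pref_def)
    then have lower: "R (vec e) (binary I (x $ j) 0)"
      using e10 trans [of "vec e" "binary I 1 0" "binary I (x $ j) 0"] xj e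
      by (simp add: indiff_def)
    obtain l where "l \<in> {0..1}"
      "indiff R (binary I (l * x $ j + (1 - l) * x $ j) (l * 1 + (1 - l) * 0)) (vec e)"
      using binary_crossing [of "x $ j" 1 "x $ j" 0 "vec e" I] xj e upper lower by auto
    then show ?thesis
      by (intro bexI [of _ l]) (simp_all add: indiff_def algebra_simps)
  qed
  then obtain f where f: "\<And>j. f j \<in> {0..1}" "\<And>j. indiff R (vec e) (binary I (x $ j) (f j))"
    by metis
  define z where "z = (\<chi> j. f j)"
  have z: "z \<in> X" "\<And>j. z $ j = f j"
    using f(1) by (auto simp: z_def X_def)
  obtain t where t: "t \<in> {0..1}" "indiff R (vec t) (binary I (y $ i) (f i))"
    using binary_certainty_equivalent [OF I nth_mem_unit [OF y] f(1)] .
  have te: "t < e"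
    using binary_mono_equivalents [OF I(1) nth_mem_unit [OF y] nth_mem_unit [OF x] f(1) t(1) e t(2) f(2)]
      less by simp
  \<comment> \<open>At every \<open>j \<noteq> i\<close> the vectors agree, so \<open>y\<close> also
    yields \<open>e\<close> there; only coordinate \<open>i\<close> yields \<open>t\<close>
    instead.\<close>
  have "strict_pref R x y \<longleftrightarrow> strict_pref R (vec e) (binary {i} t e)"
  proof (rule binary_A2 [OF I(1) x y z(1)])
    show "indiff R (vec (vec e $ j)) (binary I (x $ j) (z $ j))" for j
      using f(2) by (simp add: z(2))
    show "indiff R (vec (binary {i} t e $ j)) (binary I (y $ j) (z $ j))" for j
      using f(2) [of j] t(2) eq [of j] by (cases "j = i") (simp_all add: z(2))
  qed (use e t(1) in auto)
  then show ?thesis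
    \<comment> \<open>The comparison with constants holds for every non-empty set, here the
      singleton rather than \<open>I\<close>.\<close>
    using binary_pref_upper [of "{i}" t e] t(1) e te by simp
qed

text \<open>Each coordinate in \<open>S\<close> is switched from \<open>y\<close> to
  \<open>x\<close> separately. The induction starts at a singleton because strictness requires at
  least one switch.\<close>

lemma strict_pref_splice_vec:
  assumes x: "x \<in> X" and y: "y \<in> X"
    and "finite S" and "S \<noteq> {}" and "\<And>i. i \<in> S \<Longrightarrow> y $ i < x $ i"
  shows "strict_pref R (splice_vec S x y) y"
  using assms(3-)
proof (induction S rule: finite_ne_induct)
  have mem: "splice_vec S x y \<in> X" for S
    using x y by (simp add: X_def splice_vec_def)
  {
    case (singleton i)
    then show ?case
      using strict_pref_single_coordinate [OF mem [of "{i}"] y, of i] by (simp add: splice_vec_def)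
  next
    case (insert i S)
    then have "strict_pref R (splice_vec (insert i S) x y) (splice_vec S x y)"
      using strict_pref_single_coordinate [OF mem [of "insert i S"] mem [of S], of i] by (simp add: splice_vec_def)
    with insert show ?case
      using strict_pref_trans mem y by blast
  }
qed

lemma strongly_monotone: "strongly_monotone R"
  unfolding strongly_monotone_def
proof (intro ballI impI)
  fix x y :: "real ^ 'n"
  assume x: "x \<in> X" and y: "y \<in> X" and less: "y < x"
  let ?S = "{i. y $ i < x $ i}"
  have le: "y $ i \<le> x $ i" for i
    using less by (simp add: less_vec_def less_eq_vec_def)
  have "?S \<noteq> {}"
    using less by (auto simp: less_vec_def less_eq_vec_def not_le)
  then have "strict_pref R (splice_vec ?S x y) y"
    by (intro strict_pref_splice_vec [OF x y]) auto
  moreover have "y $ i = x $ i" if "\<not> y $ i < x $ i" for i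
    using le [of i] that by linarith
  then have "splice_vec ?S x y = x"
    by (simp add: splice_vec_def vec_eq_iff)
  ultimately show "strict_pref R x y"
    by (rule back_subst [of "\<lambda>v. strict_pref R v y"])
qed

end

theorem proposition3:
  fixes R :: "real ^ 'n \<Rightarrow> real ^ 'n \<Rightarrow> bool"
  assumes "\<And>i. \<not> null_index R i"
    and "A1 R" and "A2 R" and "A3 R"
    and "mixture_continuous R"
  shows "strongly_monotone R"
proof -
  interpret continuous_A123 R
    using assms by unfold_locales
  show ?thesis
    by (rule strongly_monotone)
qed

end
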